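(* Consider the demand-response model described in the context, in which $(p(t),q(t),r(t),S(t))$ is i.i.d. over time slots and $\eta_i c_{\mathrm{grid}}\ge\eta_e L_{\max}$. Let $\epsilon>0$, let $$\theta=\frac{\max[p_{\max},q_{\max}]}{\epsilon\,\eta_i}+\eta_e\min[L_{\max},c_{\mathrm{dis}}],$$ and suppose $0\le E(0)\le\theta+\eta_i c_{\mathrm{char}}$. Then under the algorithm DR-ESM with parameters $\theta$ and $\epsilon$ (defined in the context), $$0\le E(t)\le\theta+\eta_i c_{\mathrm{char}}\quad\text{for all }t,$$ $$f_{\mathrm{av}}^{\mathrm{E\text{-}DR}}\le f_{\mathrm{av}}^*+B\epsilon,$$ where $f_{\mathrm{av}}^{\mathrm{E\text{-}DR}}$ is the time average cost achieved by DR-ESM, $f_{\mathrm{av}}^*$ is the optimal time average cost, and $B=\frac12\left[\eta_e^2c_{\mathrm{dis}}^2+\eta_i^2c_{\mathrm{char}}^2\right]$.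
   Context: Model. Time is slotted, $t\in\{0,1,2,\dots\}$; $[x]^+=\max(x,0)$. In every slot the user chooses a load (power consumption level) $\tilde L(t)$ with $0\le\tilde L(t)\le L_{\max}$ and incurs disutility $D(\tilde L(t),S(t))$, where $S(t)$ is a system state in a finite set $\mathcal S$ and $D(\cdot,s)$ is a known function that is convex in its first argument for every $s\in\mathcal S$. Available renewable energy is $r(t)\in[0,r_{\max}]$, and the residual demand is $L(t)=\tilde L(t)-r(t)$. The unit price for buying grid power is $p(t)\in[0,p_{\max}]$, and the unit price for selling power to the grid is $q(t)\in[0,q_{\max}]$. The tuple $(p(t),q(t),r(t),S(t))$ is i.i.d. over slots, its components being possibly arbitrarily correlated. Further actions in slot $t$: $d_l(t)$ (grid power bought to serve the load), $d_c(t)$ (grid power bought to charge the storage), $d_s(t)$ (power drawn from the storage to serve the load), $h_s(t)$ (power from the storage sold to the grid), $r_c(t)$ (excess renewable energy charged into the storage). They must satisfy the constraints (i) $d_l(t),d_c(t)\ge0$, $d_l(t)+d_c(t)\le c_{\mathrm{grid}}$; (ii) $r_c(t)\ge0$, $d_c(t)+r_c(t)\le c_{\mathrm{char}}$; (iii) $h_s(t),d_s(t)\ge0$, $h_s(t)+d_s(t)\le c_{\mathrm{dis}}$; (iv) $d_l(t)+d_s(t)=[L(t)]^+$, $0\le r_c(t)\le[-L(t)]^+$. Storage dynamics: $E(t+1)=E(t)-\eta_e(d_s(t)+h_s(t))+\eta_i(d_c(t)+r_c(t))$, with constants $\eta_e\ge1$, $0<\eta_i\le1$ (the dynamics are first written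 as for an infinite-capacity storage). Energy-availability condition (EA): $E(t)\ge\eta_e(d_s(t)+h_s(t))$ for all $t$. A standing assumption is $\eta_i c_{\mathrm{grid}}\ge\eta_e L_{\max}$. Cost: $f(t)=D(\tilde L(t),S(t))+p(t)[d_l(t)+d_c(t)]-q(t)h_s(t)$, and the time average cost of a policy is $f_{\mathrm{av}}=\limsup_{t\to\infty}\frac1t\sum_{\tau=0}^{t-1}\mathbb{E}\{f(\tau)\}$. A policy (for choosing $\tilde L(t)$ and all other actions) is feasible if it ensures (EA) for all time (while satisfying $0\le\tilde L(t)\le L_{\max}$ and (i)-(iv)); $f_{\mathrm{av}}^*$ is the infimum of the time average cost over feasible policies using a finite-capacity storage. Algorithm DR-ESM (parameters $\theta>0$, $\epsilon>0$, with $V=1/\epsilon$). It uses a storage of capacity $\theta+\eta_i c_{\mathrm{char}}$. In each slot $t$, observe $E(t),r(t),p(t),q(t)$ (and $S(t)$) and set $W_h(t)=\eta_e(E(t)-\theta)+q(t)/\epsilon$, $W_l(t)=\eta_e(E(t)-\theta)+p(t)/\epsilon$, $W_c(t)=\eta_i(E(t)-\theta)+p(t)/\epsilon$, $W_r(t)=\eta_i(E(t)-\theta)$, $W_D(t)=\eta_e(E(t)-\theta)$. Then choose $(\tilde L(t),h_s(t),d_l(t),d_s(t),d_c(t),r_c(t))$ as an optimal solution of: minimize $$V D(\tilde L(t),S(t))-W_D(t)[\tilde L(t)-r(t)]^+-h_s(t)W_h(t)+d_l(t)W_l(t)+d_c(t)W_c(t)+r_c(t)W_r(t)$$ subject to (i)-(iv)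 with $L(t)=\tilde L(t)-r(t)$ and $0\le\tilde L(t)\le L_{\max}$, and perform these actions. (DR-ESM does not impose (EA) explicitly.)
   Formalization: The lower bound 0 ≤ E(t) is proved only when η_e c_dis ≤ θ − q_max/(ε η_e) (e.g. if c_dis ≤ L_max), since without such a condition selling up to c_dis can drive E(t) below 0; the upper bound and the cost bound are unconditional. *)

theory Defs
  imports "HOL-Probability.Probability"
begin

record 's dr_params =
  L_max :: real
  r_max :: real
  p_max :: real
  q_max :: real
  c_grid :: real
  c_char :: real
  c_dis :: real
  eta_e :: real
  eta_i :: real
  states :: "'s set"
  disutility :: "real \<Rightarrow> 's \<Rightarrow> real"

text \<open>The exogenous tuple observed in a slot: buying price \<open>p\<close>, selling price \<open>q\<close>,
  renewable energy \<open>r\<close>, system state \<open>S\<close>.\<close>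

type_synonym 's exo = "real \<times> real \<times> real \<times> 's"

abbreviation buy_price :: "'s exo \<Rightarrow> real" where
  "buy_price x \<equiv> fst x"

abbreviation sell_price :: "'s exo \<Rightarrow> real" where
  "sell_price x \<equiv> fst (snd x)"

abbreviation renewable :: "'s exo \<Rightarrow> real" where
  "renewable x \<equiv> fst (snd (snd x))"

abbreviation state :: "'s exo \<Rightarrow> 's" where
  "state x \<equiv> snd (snd (snd x))"

definition exo_space :: "'s dr_params \<Rightarrow> 's exo measure" where
  "exo_space P = borel \<Otimes>\<^sub>M borel \<Otimes>\<^sub>M borel \<Otimes>\<^sub>M count_space (states P)"

text \<open>\<open>load\<close> is the chosen consumption level (written with a tilde in the model description),
  not the residual demand.\<close>

record action =
  load :: real
  d_l :: real
  d_c :: real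
  d_s :: real
  h_s :: real
  r_c :: real

definition admissible :: "'s dr_params \<Rightarrow> 's exo \<Rightarrow> action \<Rightarrow> bool" where
  "admissible P x a \<longleftrightarrow>
     0 \<le> load a \<and> load a \<le> L_max P \<and>
     0 \<le> d_l a \<and> 0 \<le> d_c a \<and> d_l a + d_c a \<le> c_grid P \<and>
     0 \<le> r_c a \<and> d_c a + r_c a \<le> c_char P \<and>
     0 \<le> h_s a \<and> 0 \<le> d_s a \<and> h_s a + d_s a \<le> c_dis P \<and>
     d_l a + d_s a = max (load a - renewable x) 0 \<and>
     r_c a \<le> max (- (load a - renewable x)) 0"

text \<open>The probabilistic model. \<open>F t\<close> is the information available when acting in slot \<open>t\<close>. It
  contains the observations up to and including slot \<open>t\<close> and may contain further randomness (so
  that randomized policies and arbitrary tie-breaking are covered), but nothing about the tuples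
  of later slots.\<close>

locale demand_response = prob_space M + filtration "space M" F
  for P :: "'s dr_params"
    and M :: "'w measure"
    and F :: "nat \<Rightarrow> 'w measure"
    and X :: "nat \<Rightarrow> 'w \<Rightarrow> 's exo" +
  assumes eta_e_ge_1: "1 \<le> eta_e P"
    and eta_i_pos: "0 < eta_i P"
    and eta_i_le_1: "eta_i P \<le> 1"
    and finite_states: "finite (states P)"
    and convex_disutility: "\<And>s. s \<in> states P \<Longrightarrow> convex_on {0..L_max P} (\<lambda>l. disutility P l s)"
    and sets_F_subset: "\<And>t. sets (F t) \<subseteq> sets M"
    and exo_adapted: "\<And>t. X t \<in> measurable (F t) (exo_space P)"
    and exo_indep: "indep_vars (\<lambda>_. exo_space P) X UNIV"
    and exo_ident: "\<And>t. distr M (exo_space P) (X t) = distr M (exo_space P) (X 0)"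
    and exo_indep_past:
      "\<And>t. indep_set (sets (F t)) {X (Suc t) -` B \<inter> space M | B. B \<in> sets (exo_space P)}"
    and exo_range: "\<And>t \<omega>. \<omega> \<in> space M \<Longrightarrow>
      buy_price (X t \<omega>) \<in> {0..p_max P} \<and> sell_price (X t \<omega>) \<in> {0..q_max P} \<and>
      renewable (X t \<omega>) \<in> {0..r_max P}"

primrec energy :: "'s dr_params \<Rightarrow> real \<Rightarrow> (nat \<Rightarrow> 'w \<Rightarrow> action) \<Rightarrow> nat \<Rightarrow> 'w \<Rightarrow> real" where
  "energy P E0 A 0 \<omega> = E0"
| "energy P E0 A (Suc t) \<omega> =
     energy P E0 A t \<omega> - eta_e P * (d_s (A t \<omega>) + h_s (A t \<omega>))
       + eta_i P * (d_c (A t \<omega>) + r_c (A t \<omega>))"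

definition slot_cost :: "'s dr_params \<Rightarrow> 's exo \<Rightarrow> action \<Rightarrow> real" where
  "slot_cost P x a =
     disutility P (load a) (state x) + buy_price x * (d_l a + d_c a) - sell_price x * h_s a"

definition avg_cost ::
    "'s dr_params \<Rightarrow> 'w measure \<Rightarrow> (nat \<Rightarrow> 'w \<Rightarrow> 's exo) \<Rightarrow> (nat \<Rightarrow> 'w \<Rightarrow> action) \<Rightarrow> ereal" where
  "avg_cost P M X A =
     limsup (\<lambda>t. ereal ((1 / real t) * (\<Sum>\<tau><t. \<integral>\<omega>. slot_cost P (X \<tau> \<omega>) (A \<tau> \<omega>) \<partial>M)))"

definition adapted_policy :: "(nat \<Rightarrow> 'w measure) \<Rightarrow> (nat \<Rightarrow> 'w \<Rightarrow> action) \<Rightarrow> bool" where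
  "adapted_policy F A \<longleftrightarrow>
     (\<forall>t. \<forall>g \<in> {load, d_l, d_c, d_s, h_s, r_c}. (\<lambda>\<omega>. g (A t \<omega>)) \<in> borel_measurable (F t))"

definition feasible_policy ::
    "'s dr_params \<Rightarrow> 'w measure \<Rightarrow> (nat \<Rightarrow> 'w measure) \<Rightarrow> (nat \<Rightarrow> 'w \<Rightarrow> 's exo) \<Rightarrow> real \<Rightarrow>
     (nat \<Rightarrow> 'w \<Rightarrow> action) \<Rightarrow> bool" where
  "feasible_policy P M F X E0 A \<longleftrightarrow>
     adapted_policy F A \<and>
     (\<forall>t. \<forall>\<omega>\<in>space M. admissible P (X t \<omega>) (A t \<omega>) \<and>
        eta_e P * (d_s (A t \<omega>) + h_s (A t \<omega>)) \<le> energy P E0 A t \<omega>)"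

definition finite_capacity ::
    "'s dr_params \<Rightarrow> 'w measure \<Rightarrow> real \<Rightarrow> (nat \<Rightarrow> 'w \<Rightarrow> action) \<Rightarrow> bool" where
  "finite_capacity P M E0 A \<longleftrightarrow> (\<exists>C. \<forall>t. \<forall>\<omega>\<in>space M. energy P E0 A t \<omega> \<le> C)"

definition optimal_cost ::
    "'s dr_params \<Rightarrow> 'w measure \<Rightarrow> (nat \<Rightarrow> 'w measure) \<Rightarrow> (nat \<Rightarrow> 'w \<Rightarrow> 's exo) \<Rightarrow> real \<Rightarrow> ereal"
  where
  "optimal_cost P M F X E0 =
     (INF A \<in> {A. feasible_policy P M F X E0 A \<and> finite_capacity P M E0 A}. avg_cost P M X A)"

definition dr_esm_objective ::
    "'s dr_params \<Rightarrow> real \<Rightarrow> real \<Rightarrow> real \<Rightarrow> 's exo \<Rightarrow> action \<Rightarrow> real" where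
  "dr_esm_objective P \<theta> \<epsilon> e x a =
    (let V = 1 / \<epsilon>;
         W_h = eta_e P * (e - \<theta>) + sell_price x / \<epsilon>;
         W_l = eta_e P * (e - \<theta>) + buy_price x / \<epsilon>;
         W_c = eta_i P * (e - \<theta>) + buy_price x / \<epsilon>;
         W_r = eta_i P * (e - \<theta>);
         W_D = eta_e P * (e - \<theta>)
     in V * disutility P (load a) (state x) - W_D * max (load a - renewable x) 0
          - h_s a * W_h + d_l a * W_l + d_c a * W_c + r_c a * W_r)"

text \<open>Every action process that DR-ESM may generate: ties between optimal solutions may be broken
  in any non-anticipating way. Note that the energy-availability condition is not imposed.\<close>

definition dr_esm ::
    "'s dr_params \<Rightarrow> 'w measure \<Rightarrow> (nat \<Rightarrow> 'w measure) \<Rightarrow> (nat \<Rightarrow> 'w \<Rightarrow> 's exo) \<Rightarrow>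
     real \<Rightarrow> real \<Rightarrow> real \<Rightarrow> (nat \<Rightarrow> 'w \<Rightarrow> action) \<Rightarrow> bool" where
  "dr_esm P M F X \<theta> \<epsilon> E0 A \<longleftrightarrow>
     adapted_policy F A \<and>
     (\<forall>t. \<forall>\<omega>\<in>space M.
        is_arg_min (dr_esm_objective P \<theta> \<epsilon> (energy P E0 A t \<omega>) (X t \<omega>))
          (admissible P (X t \<omega>)) (A t \<omega>))"

text \<open>DR-ESM sells from the storage only at levels \<open>e\<close> with \<open>W_h \<ge> 0\<close>, that is, only if
  \<open>e \<ge> \<theta> - q_max / (\<epsilon> * eta_e)\<close>. The condition below says that every such level covers a full
  discharge \<open>c_dis\<close>. For \<open>\<theta> = max p_max q_max / (\<epsilon> * eta_i) + eta_e * min L_max c_dis\<close> it follows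
  from \<open>c_dis \<le> L_max\<close>, and it also holds for small \<open>\<epsilon>\<close> whenever
  \<open>max p_max q_max / eta_i > q_max / eta_e\<close>. Otherwise selling may drive the level below \<open>0\<close>, because
  \<open>h_s\<close> is bounded by \<open>c_dis\<close> and not by \<open>L_max\<close>: with \<open>disutility = 0\<close>, \<open>p = r = 0\<close>, \<open>q = 1\<close>,
  \<open>\<epsilon> = eta_e = eta_i = L_max = c_grid = c_char = 1\<close> and \<open>c_dis = 10\<close> one has \<open>\<theta> = 2\<close>, and from level
  \<open>3 / 2\<close> the unique optimal action has \<open>h_s = 10\<close> and \<open>d_c = 1\<close>, so that the next level is
  \<open>- 15 / 2\<close>.\<close>

definition sales_covered :: "'s dr_params \<Rightarrow> real \<Rightarrow> real \<Rightarrow> bool" where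
  "sales_covered P \<theta> \<epsilon> \<longleftrightarrow> eta_e P * c_dis P \<le> \<theta> - q_max P / (\<epsilon> * eta_e P)"

end

theory Submission
  imports Defs
begin

text \<open>
  The load balance rewrites the objective of DR-ESM as \<open>f / \<epsilon> + (E - \<theta>) \<Delta>\<close>, where \<open>f\<close> is the cost of
  the slot and \<open>\<Delta>\<close> the net change of the energy level (\<open>objective_eq_drift_plus_penalty\<close>). So the
  algorithm minimizes the weighted cost plus the first-order drift of the Lyapunov function
  \<open>(E - \<theta>)\<^sup>2 / 2\<close>, slot by slot and with knowledge of the current observation.

  The energy bounds compare the optimal action with a modified one. Above \<open>\<theta>\<close> it does not pay to
  charge, so the level never exceeds \<open>\<theta> + \<eta>\<^sub>i c_char\<close>. At low levels it does not pay to sell, and under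
  \<open>sales_covered\<close> the higher levels cover any sale. Nor does it pay at low levels to serve
  load from the storage while the grid connection has room. When the connection is full,
  \<open>\<eta>\<^sub>i c_grid \<ge> \<eta>\<^sub>e L_max\<close> makes the charging outweigh the discharging
  (\<open>dr_esm_upper_bound_step\<close>, \<open>dr_esm_lower_bound_step\<close>).

  For the cost, let \<open>G(e)\<close> be the expected minimum of the objective at a fixed level \<open>e\<close>, the
  expectation being over one observation. A competing policy faces in every slot an observation
  with this law, so its expected \<open>f / \<epsilon> + (e - \<theta>) \<Delta>\<close> is at least \<open>G(e)\<close>. Averaged over time, the
  \<open>\<Delta>\<close> vanish because its storage is finite, whence \<open>\<epsilon> G(e)\<close> is at most its average cost
  (\<open>expected_value_le_avg_cost\<close>). This holds for every \<open>e\<close>. The level \<open>E(t)\<close> under DR-ESM is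
  independent of the observation in slot \<open>t\<close>, so its expected objective is the mean of \<open>G(E(t))\<close>
  (\<open>expectation_best_value_le\<close>) and hence is also at most the competing average cost divided by
  \<open>\<epsilon>\<close>. The second-order part \<open>\<Delta>\<^sup>2 / 2\<close> of the drift is at most \<open>B\<close>, and telescoping the Lyapunov
  function yields the gap \<open>B \<epsilon>\<close> (\<open>dr_esm_avg_cost_le\<close>).

  The remaining work is measurability. The minimum of the objective over admissible actions must
  be jointly measurable in the level and the observation, although the disutility may be
  discontinuous at the loads \<open>0\<close> and \<open>L_max\<close>. It is obtained as an infimum over a countable family of
  actions that use rational fractions of the resources, which is dense enough because these two loads belong to the
  family (\<open>best_value_le_objective\<close>).
\<close>

section \<open>Fractions and their rational approximation\<close>

lemma fraction_bounds:
  fixes u m :: real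
  assumes "0 \<le> u" "u \<le> 1" "0 \<le> m"
  shows "0 \<le> u * m" "u * m \<le> m"
  using assms mult_right_mono[of u 1 m] by auto

lemma fraction_exists:
  fixes z m :: real
  assumes "0 \<le> z" "z \<le> m"
  shows "\<exists>u\<in>{0..1}. z = u * m"
proof (cases "m = 0")
  case True
  with assms show ?thesis by (intro bexI[of _ 0]) auto
next
  case False
  with assms show ?thesis by (intro bexI[of _ "z / m"]) auto
qed

text \<open>Rounding down, with denominators tending to infinity, keeps the endpoints fixed. This matters
  for functions that are continuous only in the interior of \<open>[0, 1]\<close>.\<close>

definition rational_below :: "real \<Rightarrow> nat \<Rightarrow> real" where
  "rational_below u n = of_int \<lfloor>u * real (Suc n)\<rfloor> / real (Suc n)"

lemma rational_below_in_grid: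
  assumes "u \<in> {0..1}"
  shows "rational_below u n \<in> \<rat> \<inter> {0..1}"
proof -
  have "rational_below u n \<in> \<rat>" unfolding rational_below_def by (intro Rats_divide) auto
  moreover have "0 \<le> rational_below u n" using assms by (auto simp: rational_below_def)
  moreover have "u * real (Suc n) \<le> real (Suc n)" using assms mult_right_mono[of u 1 "real (Suc n)"] by simp
  then have "rational_below u n \<le> 1"
    unfolding rational_below_def
    by (subst divide_le_eq_1_pos) (auto intro: order_trans[OF of_int_floor_le])
  ultimately show ?thesis by auto
qed

lemma rational_below_endpoint: "u = 0 \<or> u = 1 \<Longrightarrow> rational_below u n = u"
proof (elim disjE)
  assume u: "u = 1"
  have "\<lfloor>real (Suc n)\<rfloor> = int (Suc n)" by (rule floor_of_nat)
  then show ?thesis by (simp add: rational_below_def u del: of_nat_Suc)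
qed (simp add: rational_below_def)

lemma rational_below_tendsto: "rational_below u \<longlonglongrightarrow> u"
proof (rule tendsto_sandwich)
  show "\<forall>\<^sub>F n in sequentially. u - 1 / real (Suc n) \<le> rational_below u n"
  proof (intro always_eventually allI)
    fix n
    have "u * real (Suc n) - 1 \<le> of_int \<lfloor>u * real (Suc n)\<rfloor>" by linarith
    then have "(u * real (Suc n) - 1) / real (Suc n) \<le> rational_below u n"
      unfolding rational_below_def by (intro divide_right_mono) auto
    then show "u - 1 / real (Suc n) \<le> rational_below u n"
      by (simp add: diff_divide_distrib del: of_nat_Suc)
  qed
  show "\<forall>\<^sub>F n in sequentially. rational_below u n \<le> u"
    by (intro always_eventually allI)
      (simp add: rational_below_def divide_le_eq del: of_nat_Suc)
  have "(\<lambda>n. u - 1 / real (Suc n)) \<longlonglongrightarrow> u - 0"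
    using LIMSEQ_inverse_real_of_nat by (intro tendsto_diff tendsto_const) (simp add: inverse_eq_divide)
  then show "(\<lambda>n. u - 1 / real (Suc n)) \<longlonglongrightarrow> u" by simp
qed auto

definition fraction_grid :: "(real \<times> real \<times> real \<times> real \<times> real) set" where
  "fraction_grid = (\<rat> \<inter> {0..1}) \<times> (\<rat> \<inter> {0..1}) \<times> (\<rat> \<inter> {0..1}) \<times> (\<rat> \<inter> {0..1}) \<times> (\<rat> \<inter> {0..1})"

lemma fraction_grid_nonempty: "fraction_grid \<noteq> {}"
proof -
  have "(0, 0, 0, 0, 0) \<in> fraction_grid" by (simp add: fraction_grid_def)
  then show ?thesis by blast
qed

section \<open>One slot of the controlled storage\<close>

definition net_charge :: "'s dr_params \<Rightarrow> action \<Rightarrow> real" where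
  "net_charge P a = eta_i P * (d_c a + r_c a) - eta_e P * (d_s a + h_s a)"

lemma energy_Suc_net_charge:
  "energy P E0 A (Suc t) \<omega> = energy P E0 A t \<omega> + net_charge P (A t \<omega>)"
  by (simp add: net_charge_def)

lemma energy_eq_sum_net_charge:
  "energy P E0 A t \<omega> = E0 + (\<Sum>\<tau><t. net_charge P (A \<tau> \<omega>))"
  by (induction t) (simp_all add: net_charge_def)

text \<open>The load balance \<open>d_l + d_s = [load - r]\<^sup>+\<close> turns the load terms of the objective into
  discharge terms. What remains is the penalty \<open>V f\<close> plus the first-order drift of
  \<open>(e - \<theta>)\<^sup>2 / 2\<close>, so DR-ESM greedily minimizes drift plus penalty.\<close>

lemma objective_eq_drift_plus_penalty:
  assumes "admissible P x a"
  shows "dr_esm_objective P \<theta> \<epsilon> e x a = slot_cost P x a / \<epsilon> + (e - \<theta>) * net_charge P a"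
proof -
  have m: "max (load a - renewable x) 0 = d_l a + d_s a"
    using assms by (simp add: admissible_def)
  show ?thesis
    unfolding dr_esm_objective_def Let_def m slot_cost_def net_charge_def
    by (simp add: field_simps add_divide_distrib diff_divide_distrib)
qed

definition in_range :: "'s dr_params \<Rightarrow> 's exo \<Rightarrow> bool" where
  "in_range P x \<longleftrightarrow> buy_price x \<in> {0..p_max P} \<and> sell_price x \<in> {0..q_max P} \<and>
     renewable x \<in> {0..r_max P} \<and> state x \<in> states P"

locale storage_model =
  fixes P :: "'s dr_params" and \<theta> \<epsilon> :: real
  assumes e_ge_1: "1 \<le> eta_e P"
    and i_pos: "0 < eta_i P"
    and i_le_1: "eta_i P \<le> 1"
    and states_finite: "finite (states P)"
    and convex_D: "\<And>s. s \<in> states P \<Longrightarrow> convex_on {0..L_max P} (\<lambda>l. disutility P l s)"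
    and eps_pos: "0 < \<epsilon>"
    and L_max_nonneg: "0 \<le> L_max P"
    and c_char_nonneg: "0 \<le> c_char P"
    and c_dis_nonneg: "0 \<le> c_dis P"
    and grid_covers_load: "eta_e P * L_max P \<le> eta_i P * c_grid P"
begin

lemma L_max_le_c_grid: "L_max P \<le> c_grid P"
proof -
  have 1: "L_max P \<le> eta_e P * L_max P"
    using e_ge_1 L_max_nonneg mult_right_mono[of 1 "eta_e P" "L_max P"] by simp
  then have "0 \<le> eta_i P * c_grid P" using grid_covers_load L_max_nonneg by linarith
  then have "0 \<le> c_grid P" using i_pos by (simp add: zero_le_mult_iff)
  then have "eta_i P * c_grid P \<le> c_grid P"
    using i_le_1 mult_right_mono[of "eta_i P" 1 "c_grid P"] by simp
  with 1 grid_covers_load show ?thesis by linarith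
qed

lemma abs_net_charge_le:
  assumes "admissible P x a"
  shows "\<bar>net_charge P a\<bar> \<le> eta_i P * c_char P + eta_e P * c_dis P"
proof -
  have b: "0 \<le> d_c a + r_c a" "d_c a + r_c a \<le> c_char P" "0 \<le> d_s a + h_s a" "d_s a + h_s a \<le> c_dis P"
    using assms by (auto simp: admissible_def)
  have "0 \<le> eta_i P * (d_c a + r_c a)" "eta_i P * (d_c a + r_c a) \<le> eta_i P * c_char P"
    "0 \<le> eta_e P * (d_s a + h_s a)" "eta_e P * (d_s a + h_s a) \<le> eta_e P * c_dis P"
    using b i_pos e_ge_1 by (auto intro!: mult_left_mono mult_nonneg_nonneg)
  then show ?thesis unfolding net_charge_def by linarith
qed

text \<open>Charging and discharging enter with opposite signs, so the cross term of the square is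
  nonpositive. This is why the constant is a sum of two squares and not the square of a sum.\<close>

lemma net_charge_square_le:
  assumes "admissible P x a"
  shows "(net_charge P a)\<^sup>2 \<le> (eta_e P)\<^sup>2 * (c_dis P)\<^sup>2 + (eta_i P)\<^sup>2 * (c_char P)\<^sup>2"
proof -
  define u v where "u = eta_i P * (d_c a + r_c a)" and "v = eta_e P * (d_s a + h_s a)"
  have b: "0 \<le> d_c a + r_c a" "d_c a + r_c a \<le> c_char P" "0 \<le> d_s a + h_s a" "d_s a + h_s a \<le> c_dis P"
    using assms by (auto simp: admissible_def)
  have u: "0 \<le> u" "u \<le> eta_i P * c_char P" and v: "0 \<le> v" "v \<le> eta_e P * c_dis P"
    unfolding u_def v_def using b i_pos e_ge_1 by (auto intro!: mult_left_mono mult_nonneg_nonneg)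
  have "(net_charge P a)\<^sup>2 = u\<^sup>2 + v\<^sup>2 - 2 * u * v"
    by (simp add: net_charge_def u_def v_def power2_diff)
  also have "\<dots> \<le> u\<^sup>2 + v\<^sup>2" using u v by simp
  also have "\<dots> \<le> (eta_i P * c_char P)\<^sup>2 + (eta_e P * c_dis P)\<^sup>2"
    using u v by (intro add_mono power_mono)
  finally show ?thesis by (simp add: power_mult_distrib)
qed

section \<open>Bounds on the stored energy\<close>

text \<open>Above \<open>\<theta>\<close> both charging weights \<open>W_c\<close> and \<open>W_r\<close> are positive, so dropping all charging
  lowers the objective and breaks no constraint. The level therefore rises only from levels up to
  \<open>\<theta>\<close>, by at most a full charge.\<close>

lemma dr_esm_no_charge_above_threshold:
  assumes opt: "is_arg_min (dr_esm_objective P \<theta> \<epsilon> e x) (admissible P x) a"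
    and x: "in_range P x" and e: "\<theta> < e"
  shows "d_c a = 0 \<and> r_c a = 0"
proof (rule ccontr)
  assume nz: "\<not> (d_c a = 0 \<and> r_c a = 0)"
  have adm: "admissible P x a" using opt by (simp add: is_arg_min_def)
  let ?b = "a\<lparr>d_c := 0, r_c := 0\<rparr>"
  have "admissible P x ?b"
    using adm c_char_nonneg by (auto simp: admissible_def)
  then have le: "dr_esm_objective P \<theta> \<epsilon> e x a \<le> dr_esm_objective P \<theta> \<epsilon> e x ?b"
    using opt by (auto simp: is_arg_min_def not_less)
  have k: "0 < eta_i P * (e - \<theta>)" using i_pos e by simp
  have p: "0 \<le> buy_price x / \<epsilon>" using x eps_pos by (simp add: in_range_def)
  have diff: "dr_esm_objective P \<theta> \<epsilon> e x a - dr_esm_objective P \<theta> \<epsilon> e x ?b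
      = d_c a * (eta_i P * (e - \<theta>) + buy_price x / \<epsilon>) + r_c a * (eta_i P * (e - \<theta>))"
    by (simp add: dr_esm_objective_def Let_def)
  have "0 < d_c a * (eta_i P * (e - \<theta>) + buy_price x / \<epsilon>) + r_c a * (eta_i P * (e - \<theta>))"
  proof -
    have W: "0 < eta_i P * (e - \<theta>) + buy_price x / \<epsilon>" using k p by simp
    consider "0 < d_c a" "0 \<le> r_c a" | "0 \<le> d_c a" "0 < r_c a"
      using adm nz by (fastforce simp: admissible_def)
    then show ?thesis
    proof cases
      case 1
      then show ?thesis
        using mult_pos_pos[OF _ W] mult_nonneg_nonneg[OF _ less_imp_le[OF k]] by (intro add_pos_nonneg) auto
    next
      case 2
      then show ?thesis
        using mult_nonneg_nonneg[OF _ less_imp_le[OF W]] mult_pos_pos[OF _ k] by (intro add_nonneg_pos) auto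
    qed
  qed
  with le diff show False by linarith
qed

lemma dr_esm_upper_bound_step:
  assumes opt: "is_arg_min (dr_esm_objective P \<theta> \<epsilon> e x) (admissible P x) a"
    and x: "in_range P x" and e: "e \<le> \<theta> + eta_i P * c_char P"
  shows "e + net_charge P a \<le> \<theta> + eta_i P * c_char P"
proof -
  have adm: "admissible P x a" using opt by (simp add: is_arg_min_def)
  have v: "0 \<le> eta_e P * (d_s a + h_s a)"
    using adm e_ge_1 by (auto simp: admissible_def)
  show ?thesis
  proof (cases "\<theta> < e")
    case True
    then show ?thesis
      using dr_esm_no_charge_above_threshold[OF opt x] v e by (simp add: net_charge_def)
  next
    case False
    have "eta_i P * (d_c a + r_c a) \<le> eta_i P * c_char P"
      using adm i_pos by (auto simp: admissible_def)
    with False v show ?thesis by (simp add: net_charge_def)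
  qed
qed

text \<open>Below the stated level \<open>W_h\<close> is negative, and selling nothing is strictly better.\<close>

lemma dr_esm_sale_level:
  assumes opt: "is_arg_min (dr_esm_objective P \<theta> \<epsilon> e x) (admissible P x) a"
    and x: "in_range P x" and h: "h_s a \<noteq> 0"
  shows "\<theta> - q_max P / (\<epsilon> * eta_e P) \<le> e"
proof (rule ccontr)
  assume "\<not> ?thesis"
  then have "e - \<theta> < - (q_max P / (\<epsilon> * eta_e P))" by simp
  then have "eta_e P * (e - \<theta>) < eta_e P * (- (q_max P / (\<epsilon> * eta_e P)))"
    using e_ge_1 by (intro mult_strict_left_mono) auto
  also have "\<dots> = - (q_max P / \<epsilon>)" using e_ge_1 eps_pos by (simp add: field_simps)
  also have "\<dots> \<le> - (sell_price x / \<epsilon>)" using x eps_pos by (simp add: in_range_def divide_right_mono)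
  finally have W: "eta_e P * (e - \<theta>) + sell_price x / \<epsilon> < 0" by simp
  have adm: "admissible P x a" using opt by (simp add: is_arg_min_def)
  let ?b = "a\<lparr>h_s := 0\<rparr>"
  have hpos: "0 < h_s a" using adm h by (auto simp: admissible_def)
  have "admissible P x ?b" using adm by (auto simp: admissible_def)
  then have le: "dr_esm_objective P \<theta> \<epsilon> e x a \<le> dr_esm_objective P \<theta> \<epsilon> e x ?b"
    using opt by (auto simp: is_arg_min_def not_less)
  have "dr_esm_objective P \<theta> \<epsilon> e x a - dr_esm_objective P \<theta> \<epsilon> e x ?b
      = - (h_s a * (eta_e P * (e - \<theta>) + sell_price x / \<epsilon>))"
    by (simp add: dr_esm_objective_def Let_def)
  moreover have "h_s a * (eta_e P * (e - \<theta>) + sell_price x / \<epsilon>) < 0"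
    using hpos W by (rule mult_pos_neg)
  ultimately show False using le by simp
qed

text \<open>At a level where \<open>W_l < 0\<close>, serving the load from the grid beats serving it from the storage,
  so the storage serves load only when the grid connection is saturated.\<close>

lemma dr_esm_discharge_saturates_grid:
  assumes opt: "is_arg_min (dr_esm_objective P \<theta> \<epsilon> e x) (admissible P x) a"
    and W: "eta_e P * (e - \<theta>) + buy_price x / \<epsilon> < 0" and d: "d_s a \<noteq> 0"
  shows "d_l a + d_c a = c_grid P"
proof (rule ccontr)
  assume ns: "d_l a + d_c a \<noteq> c_grid P"
  have adm: "admissible P x a" using opt by (simp add: is_arg_min_def)
  define \<delta> where "\<delta> = min (d_s a) (c_grid P - (d_l a + d_c a))"
  have \<delta>: "0 < \<delta>" using adm ns d by (auto simp: admissible_def \<delta>_def)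
  let ?b = "a\<lparr>d_s := d_s a - \<delta>, d_l := d_l a + \<delta>\<rparr>"
  have "admissible P x ?b"
    using adm \<delta> unfolding admissible_def by (auto simp: \<delta>_def)
  then have le: "dr_esm_objective P \<theta> \<epsilon> e x a \<le> dr_esm_objective P \<theta> \<epsilon> e x ?b"
    using opt by (auto simp: is_arg_min_def not_less)
  have "dr_esm_objective P \<theta> \<epsilon> e x ?b - dr_esm_objective P \<theta> \<epsilon> e x a
      = \<delta> * (eta_e P * (e - \<theta>) + buy_price x / \<epsilon>)"
    by (simp add: dr_esm_objective_def Let_def algebra_simps)
  moreover have "\<delta> * (eta_e P * (e - \<theta>) + buy_price x / \<epsilon>) < 0"
    using \<delta> W by (rule mult_pos_neg)
  ultimately show False using le by simp
qed

text \<open>There are three regimes. If something is sold, the level covers a full discharge. If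
  nothing is sold and the level is at least \<open>\<eta>\<^sub>e min(L_max, c_dis)\<close>, it covers whatever the load can
  draw. Below that, \<open>\<theta>\<close> is large enough to make \<open>W_l\<close> negative, and the level cannot decrease:
  either the storage serves no load or the grid connection is saturated.\<close>

lemma dr_esm_lower_bound_step:
  assumes opt: "is_arg_min (dr_esm_objective P \<theta> \<epsilon> e x) (admissible P x) a"
    and x: "in_range P x" and e: "0 \<le> e"
    and \<theta>: "\<theta> = max (p_max P) (q_max P) / (\<epsilon> * eta_i P) + eta_e P * min (L_max P) (c_dis P)"
    and cov: "sales_covered P \<theta> \<epsilon>"
  shows "0 \<le> e + net_charge P a"
proof -
  have adm: "admissible P x a" using opt by (simp add: is_arg_min_def)
  have u: "0 \<le> eta_i P * (d_c a + r_c a)" using adm i_pos by (auto simp: admissible_def)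
  have ds: "d_s a \<le> min (L_max P) (c_dis P)"
    using adm x by (auto simp: admissible_def in_range_def)
  consider "h_s a \<noteq> 0" | "h_s a = 0" "eta_e P * min (L_max P) (c_dis P) \<le> e"
    | "h_s a = 0" "e < eta_e P * min (L_max P) (c_dis P)" by linarith
  then show ?thesis
  proof cases
    case 1
    have "eta_e P * (d_s a + h_s a) \<le> eta_e P * c_dis P"
      using adm e_ge_1 by (auto simp: admissible_def)
    also have "\<dots> \<le> e"
      using dr_esm_sale_level[OF opt x 1] cov by (simp add: sales_covered_def)
    finally show ?thesis using u by (simp add: net_charge_def)
  next
    case 2
    have "eta_e P * d_s a \<le> eta_e P * min (L_max P) (c_dis P)"
      using ds e_ge_1 by (intro mult_left_mono) auto
    with 2 u show ?thesis by (simp add: net_charge_def)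
  next
    case 3
    show ?thesis
    proof (cases "d_s a = 0")
      case True
      with 3 u e show ?thesis by (simp add: net_charge_def)
    next
      case False
      have pm: "0 \<le> max (p_max P) (q_max P)" using x by (auto simp: in_range_def)
      have "e - \<theta> < - (max (p_max P) (q_max P) / (\<epsilon> * eta_i P))"
        using 3 \<theta> by linarith
      then have "eta_e P * (e - \<theta>) < eta_e P * - (max (p_max P) (q_max P) / (\<epsilon> * eta_i P))"
        using e_ge_1 by (intro mult_strict_left_mono) auto
      also have "\<dots> = - ((eta_e P / eta_i P) * (max (p_max P) (q_max P) / \<epsilon>))"
        using i_pos eps_pos by (simp add: field_simps)
      also have "\<dots> \<le> - (max (p_max P) (q_max P) / \<epsilon>)"
      proof -
        have "1 \<le> eta_e P / eta_i P" using i_pos i_le_1 e_ge_1 by (simp add: field_simps)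
        then show ?thesis using pm eps_pos
            mult_right_mono[of 1 "eta_e P / eta_i P" "max (p_max P) (q_max P) / \<epsilon>"] by simp
      qed
      also have "\<dots> \<le> - (buy_price x / \<epsilon>)"
        using x eps_pos by (auto simp: in_range_def intro!: divide_right_mono)
      finally have W: "eta_e P * (e - \<theta>) + buy_price x / \<epsilon> < 0" by simp
      have sat: "d_c a = c_grid P - d_l a"
        using dr_esm_discharge_saturates_grid[OF opt W False] by simp
      \<comment> \<open>The saturated grid draws at least as much for charging as the storage loses, since
        \<open>\<eta>\<^sub>i c_grid \<ge> \<eta>\<^sub>e L_max\<close> and the load is at most \<open>L_max\<close>.\<close>
      have dl: "0 \<le> d_l a" "d_l a + d_s a \<le> L_max P" "0 \<le> r_c a"
        using adm x by (auto simp: admissible_def in_range_def)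
      have "eta_i P * d_l a \<le> eta_e P * d_l a"
        using dl e_ge_1 i_le_1 by (intro mult_right_mono) auto
      moreover have "eta_e P * (d_l a + d_s a) \<le> eta_e P * L_max P"
        using dl e_ge_1 by (intro mult_left_mono) auto
      moreover have "0 \<le> eta_i P * r_c a" using dl i_pos by simp
      ultimately have "0 \<le> net_charge P a"
        using grid_covers_load 3 unfolding net_charge_def sat by (simp add: algebra_simps)
      with e show ?thesis by simp
    qed
  qed
qed

section \<open>Convex disutility\<close>

lemma disutility_bounded: "\<exists>K. \<forall>s\<in>states P. \<forall>l\<in>{0..L_max P}. \<bar>disutility P l s\<bar> \<le> K"
proof -
  have one: "\<exists>K. \<forall>l\<in>{0..L_max P}. \<bar>disutility P l s\<bar> \<le> K" if s: "s \<in> states P" for s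
  proof -
    let ?f = "\<lambda>l. disutility P l s"
    define m where "m = max (?f 0) (?f (L_max P))"
    have cvx: "convex_on {0..L_max P} ?f" using convex_D[OF s] .
    have up: "?f l \<le> m" if l: "l \<in> {0..L_max P}" for l
    proof (cases "L_max P = 0")
      case True
      with l show ?thesis by (auto simp: m_def)
    next
      case False
      with L_max_nonneg have Lp: "0 < L_max P" by simp
      define u where "u = l / L_max P"
      have u: "0 \<le> u" "u \<le> 1" and lu: "l = (1 - u) *\<^sub>R 0 + u *\<^sub>R L_max P"
        using l Lp by (auto simp: u_def)
      have "?f l \<le> (1 - u) * ?f 0 + u * ?f (L_max P)"
        unfolding lu using u Lp by (intro convex_onD[OF cvx]) auto
      also have "\<dots> \<le> (1 - u) * m + u * m"
        using u by (intro add_mono mult_left_mono) (auto simp: m_def)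
      finally show ?thesis by (simp add: algebra_simps)
    qed
    \<comment> \<open>Reflection in the midpoint turns the upper bound into a lower bound.\<close>
    have low: "2 * ?f (L_max P / 2) - m \<le> ?f l" if l: "l \<in> {0..L_max P}" for l
    proof -
      have mid: "L_max P / 2 = (1 - 1/2) *\<^sub>R l + (1/2) *\<^sub>R (L_max P - l)" by (simp add: field_simps)
      have "?f (L_max P / 2) \<le> (1 - 1/2) * ?f l + (1/2) * ?f (L_max P - l)"
        unfolding mid using l by (intro convex_onD[OF cvx]) auto
      moreover have "?f (L_max P - l) \<le> m" using l by (intro up) auto
      ultimately show ?thesis by simp
    qed
    show ?thesis
    proof (intro exI[of _ "\<bar>m\<bar> + \<bar>2 * ?f (L_max P / 2) - m\<bar>"] ballI)
      fix l assume "l \<in> {0..L_max P}"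
      from up[OF this] low[OF this]
      show "\<bar>?f l\<bar> \<le> \<bar>m\<bar> + \<bar>2 * ?f (L_max P / 2) - m\<bar>" by linarith
    qed
  qed
  then obtain K where K: "\<And>s l. s \<in> states P \<Longrightarrow> l \<in> {0..L_max P} \<Longrightarrow> \<bar>disutility P l s\<bar> \<le> K s"
    by metis
  have "\<bar>disutility P l s\<bar> \<le> (\<Sum>s\<in>states P. \<bar>K s\<bar>)" if "s \<in> states P" "l \<in> {0..L_max P}" for s l
  proof -
    have "\<bar>disutility P l s\<bar> \<le> \<bar>K s\<bar>" using K[OF that] by linarith
    also have "\<dots> \<le> (\<Sum>s\<in>states P. \<bar>K s\<bar>)"
      using that states_finite by (intro member_le_sum) auto
    finally show ?thesis .
  qed
  then show ?thesis by blast
qed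

lemma continuous_on_disutility_interior:
  assumes "s \<in> states P"
  shows "continuous_on {0<..<L_max P} (\<lambda>l. disutility P l s)"
proof (rule convex_on_continuous)
  show "convex_on {0<..<L_max P} (\<lambda>l. disutility P l s)"
    by (rule convex_on_subset[OF convex_D[OF assms]]) auto
qed simp

text \<open>A convex function may jump at the endpoints of its interval, so these are treated apart from
  the interior, where it is continuous.\<close>

lemma borel_measurable_disutility:
  assumes s: "s \<in> states P"
    and l: "l \<in> borel_measurable N" "\<And>\<omega>. \<omega> \<in> space N \<Longrightarrow> l \<omega> \<in> {0..L_max P}"
  shows "(\<lambda>\<omega>. disutility P (l \<omega>) s) \<in> borel_measurable N"
proof -
  let ?f = "\<lambda>l. disutility P l s"
  have [measurable]: "l \<in> borel_measurable N" by fact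
  have [measurable]: "(\<lambda>y. indicator {0<..<L_max P} y *\<^sub>R ?f y) \<in> borel_measurable borel"
    by (rule borel_measurable_continuous_on_indicator[OF _ continuous_on_disutility_interior[OF s]]) simp
  have "(\<lambda>\<omega>. if l \<omega> = 0 then ?f 0 else if l \<omega> = L_max P then ?f (L_max P)
      else indicator {0<..<L_max P} (l \<omega>) *\<^sub>R ?f (l \<omega>)) \<in> borel_measurable N"
    by measurable
  then show ?thesis
    by (rule measurable_cong[THEN iffD1, rotated]) (use l(2) in \<open>force simp: indicator_def\<close>)
qed

lemma slot_cost_bounded:
  "\<exists>K. \<forall>x a. in_range P x \<longrightarrow> admissible P x a \<longrightarrow> \<bar>slot_cost P x a\<bar> \<le> K"
proof -
  obtain K where K: "\<And>s l. s \<in> states P \<Longrightarrow> l \<in> {0..L_max P} \<Longrightarrow> \<bar>disutility P l s\<bar> \<le> K"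
    using disutility_bounded by blast
  have "\<bar>slot_cost P x a\<bar> \<le> K + p_max P * c_grid P + q_max P * c_dis P"
    if x: "in_range P x" and a: "admissible P x a" for x a
  proof -
    have 1: "\<bar>disutility P (load a) (state x)\<bar> \<le> K"
      using x a by (intro K) (auto simp: in_range_def admissible_def)
    have 2: "0 \<le> buy_price x * (d_l a + d_c a)" "buy_price x * (d_l a + d_c a) \<le> p_max P * c_grid P"
      "0 \<le> sell_price x * h_s a" "sell_price x * h_s a \<le> q_max P * c_dis P"
      using x a by (auto simp: in_range_def admissible_def intro!: mult_mono mult_nonneg_nonneg)
    from 1 2 show ?thesis unfolding slot_cost_def by linarith
  qed
  then show ?thesis by blast
qed

section \<open>The optimal value of the one-slot problem\<close>

text \<open>Given the observation, an admissible action amounts to five independent fractions: of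
  \<open>L_max\<close>, and then of what the earlier choices leave of each resource. For a fixed
  tuple of fractions the action depends measurably on the observation, and its load is constant.\<close>

definition action_of_fractions ::
    "'s exo \<Rightarrow> real \<times> real \<times> real \<times> real \<times> real \<Rightarrow> action" where
  "action_of_fractions x u = (case u of (u0, u1, u2, u3, u4) \<Rightarrow>
     let y = u0 * L_max P - renewable x;
         ds = u1 * min (max y 0) (c_dis P);
         dl = max y 0 - ds;
         dc = u2 * min (c_char P) (c_grid P - dl)
     in \<lparr>load = u0 * L_max P, d_l = dl, d_c = dc, d_s = ds,
         h_s = u3 * (c_dis P - ds), r_c = u4 * min (max (- y) 0) (c_char P - dc)\<rparr>)"

lemma admissible_action_of_fractions:
  assumes x: "in_range P x"
    and u: "{u0, u1, u2, u3, u4} \<subseteq> {0..1}"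
  shows "admissible P x (action_of_fractions x (u0, u1, u2, u3, u4))"
proof -
  define y where "y = u0 * L_max P - renewable x"
  define ds where "ds = u1 * min (max y 0) (c_dis P)"
  define dl where "dl = max y 0 - ds"
  define dc where "dc = u2 * min (c_char P) (c_grid P - dl)"
  define hs where "hs = u3 * (c_dis P - ds)"
  define rc where "rc = u4 * min (max (- y) 0) (c_char P - dc)"
  have L: "0 \<le> u0 * L_max P" "u0 * L_max P \<le> L_max P"
    using fraction_bounds[of u0 "L_max P"] u L_max_nonneg by auto
  have "0 \<le> ds" "ds \<le> min (max y 0) (c_dis P)"
    unfolding ds_def using fraction_bounds[of u1 "min (max y 0) (c_dis P)"] u c_dis_nonneg by auto
  note ds = this
  have y: "max y 0 \<le> L_max P" using L x L_max_nonneg by (auto simp: y_def in_range_def)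
  have dl: "0 \<le> dl" "dl \<le> c_grid P" using ds y L_max_le_c_grid by (auto simp: dl_def)
  have "0 \<le> dc" "dc \<le> min (c_char P) (c_grid P - dl)"
    unfolding dc_def using fraction_bounds[of u2 "min (c_char P) (c_grid P - dl)"] u c_char_nonneg dl
    by auto
  note dc = this
  have hs: "0 \<le> hs" "hs \<le> c_dis P - ds"
    unfolding hs_def using fraction_bounds[of u3 "c_dis P - ds"] u ds by auto
  have "0 \<le> rc" "rc \<le> min (max (- y) 0) (c_char P - dc)"
    unfolding rc_def using fraction_bounds[of u4 "min (max (- y) 0) (c_char P - dc)"] u dc by auto
  note rc = this
  have eq: "action_of_fractions x (u0, u1, u2, u3, u4) =
      \<lparr>load = u0 * L_max P, d_l = dl, d_c = dc, d_s = ds, h_s = hs, r_c = rc\<rparr>"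
    by (simp add: action_of_fractions_def Let_def y_def ds_def dl_def dc_def hs_def rc_def)
  show ?thesis
    unfolding eq admissible_def using L ds dl dc hs rc
    by (auto simp: dl_def y_def)
qed

lemma admissible_imp_fractions:
  assumes a: "admissible P x a"
  obtains u0 u1 u2 u3 u4 where "{u0, u1, u2, u3, u4} \<subseteq> {0..1}"
    "a = action_of_fractions x (u0, u1, u2, u3, u4)"
proof -
  let ?y = "load a - renewable x"
  have m: "max ?y 0 = d_l a + d_s a" using a by (simp add: admissible_def)
  obtain u0 where u0: "u0 \<in> {0..1}" "load a = u0 * L_max P"
    using fraction_exists[of "load a" "L_max P"] a by (auto simp: admissible_def)
  obtain u1 where u1: "u1 \<in> {0..1}" "d_s a = u1 * min (max ?y 0) (c_dis P)"
    using fraction_exists[of "d_s a" "min (max ?y 0) (c_dis P)"] a by (auto simp: admissible_def)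
  obtain u2 where u2: "u2 \<in> {0..1}" "d_c a = u2 * min (c_char P) (c_grid P - d_l a)"
    using fraction_exists[of "d_c a" "min (c_char P) (c_grid P - d_l a)"] a by (auto simp: admissible_def)
  obtain u3 where u3: "u3 \<in> {0..1}" "h_s a = u3 * (c_dis P - d_s a)"
    using fraction_exists[of "h_s a" "c_dis P - d_s a"] a by (auto simp: admissible_def)
  obtain u4 where u4: "u4 \<in> {0..1}" "r_c a = u4 * min (max (- ?y) 0) (c_char P - d_c a)"
    using fraction_exists[of "r_c a" "min (max (- ?y) 0) (c_char P - d_c a)"] a
    by (auto simp: admissible_def)
  have dl: "d_l a = max ?y 0 - d_s a" using m by simp
  have "a = action_of_fractions x (u0, u1, u2, u3, u4)"
    unfolding action_of_fractions_def Let_def prod.case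
    unfolding u0(2)[symmetric] u1(2)[symmetric] dl[symmetric] u2(2)[symmetric] u3(2)[symmetric]
      u4(2)[symmetric]
    by simp
  with u0(1) u1(1) u2(1) u3(1) u4(1) show ?thesis by (intro that[of u0 u1 u2 u3 u4]) auto
qed

text \<open>The infimum runs over a countable set of actions only. This makes it jointly measurable in the
  energy level and the observation, with no measurable selection of optimal actions.\<close>

definition best_value :: "real \<Rightarrow> 's exo \<Rightarrow> real" where
  "best_value e x = (INF u\<in>fraction_grid. dr_esm_objective P \<theta> \<epsilon> e x (action_of_fractions x u))"

lemma admissible_fraction_grid:
  assumes "in_range P x" "u \<in> fraction_grid"
  shows "admissible P x (action_of_fractions x u)"
  using assms by (cases u) (auto simp: fraction_grid_def intro!: admissible_action_of_fractions)

lemma objective_bounded: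
  "\<exists>K. \<forall>e x a. in_range P x \<longrightarrow> admissible P x a \<longrightarrow>
     \<bar>dr_esm_objective P \<theta> \<epsilon> e x a\<bar> \<le> K + \<bar>e - \<theta>\<bar> * (eta_i P * c_char P + eta_e P * c_dis P)"
proof -
  obtain K where K: "\<And>x a. in_range P x \<Longrightarrow> admissible P x a \<Longrightarrow> \<bar>slot_cost P x a\<bar> \<le> K"
    using slot_cost_bounded by blast
  have "\<bar>dr_esm_objective P \<theta> \<epsilon> e x a\<bar> \<le> K / \<epsilon> + \<bar>e - \<theta>\<bar> * (eta_i P * c_char P + eta_e P * c_dis P)"
    if x: "in_range P x" and a: "admissible P x a" for e x a
  proof -
    have "\<bar>dr_esm_objective P \<theta> \<epsilon> e x a\<bar> \<le> \<bar>slot_cost P x a\<bar> / \<epsilon> + \<bar>e - \<theta>\<bar> * \<bar>net_charge P a\<bar>"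
      unfolding objective_eq_drift_plus_penalty[OF a]
      using abs_triangle_ineq[of "slot_cost P x a / \<epsilon>" "(e - \<theta>) * net_charge P a"] eps_pos
      by (simp add: abs_mult)
    also have "\<dots> \<le> K / \<epsilon> + \<bar>e - \<theta>\<bar> * (eta_i P * c_char P + eta_e P * c_dis P)"
      using K[OF x a] abs_net_charge_le[OF a] eps_pos
      by (intro add_mono divide_right_mono mult_left_mono) auto
    finally show ?thesis .
  qed
  then show ?thesis by blast
qed

lemma bdd_below_objective_grid:
  assumes "in_range P x"
  shows "bdd_below ((\<lambda>u. dr_esm_objective P \<theta> \<epsilon> e x (action_of_fractions x u)) ` fraction_grid)"
proof -
  obtain K where K: "\<And>e x a. in_range P x \<Longrightarrow> admissible P x a \<Longrightarrow>
     \<bar>dr_esm_objective P \<theta> \<epsilon> e x a\<bar> \<le> K + \<bar>e - \<theta>\<bar> * (eta_i P * c_char P + eta_e P * c_dis P)"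
    using objective_bounded by blast
  show ?thesis
  proof (rule bdd_belowI2)
    fix u assume "u \<in> fraction_grid"
    from K[OF assms admissible_fraction_grid[OF assms this], of e]
    show "- (K + \<bar>e - \<theta>\<bar> * (eta_i P * c_char P + eta_e P * c_dis P))
        \<le> dr_esm_objective P \<theta> \<epsilon> e x (action_of_fractions x u)" by linarith
  qed
qed

lemma best_value_bounded:
  "\<exists>K. \<forall>e x. in_range P x \<longrightarrow>
     \<bar>best_value e x\<bar> \<le> K + \<bar>e - \<theta>\<bar> * (eta_i P * c_char P + eta_e P * c_dis P)"
proof -
  obtain K where K: "\<And>e x a. in_range P x \<Longrightarrow> admissible P x a \<Longrightarrow>
     \<bar>dr_esm_objective P \<theta> \<epsilon> e x a\<bar> \<le> K + \<bar>e - \<theta>\<bar> * (eta_i P * c_char P + eta_e P * c_dis P)"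
    using objective_bounded by blast
  have "\<bar>best_value e x\<bar> \<le> K + \<bar>e - \<theta>\<bar> * (eta_i P * c_char P + eta_e P * c_dis P)"
    if x: "in_range P x" for e x
  proof -
    let ?R = "K + \<bar>e - \<theta>\<bar> * (eta_i P * c_char P + eta_e P * c_dis P)"
    have b: "\<bar>dr_esm_objective P \<theta> \<epsilon> e x (action_of_fractions x u)\<bar> \<le> ?R" if "u \<in> fraction_grid" for u
      using K[OF x admissible_fraction_grid[OF x that]] .
    have "- ?R \<le> best_value e x"
      unfolding best_value_def using b
      by (intro cINF_greatest[OF fraction_grid_nonempty]) (fastforce simp: abs_le_iff)
    moreover obtain u where u: "u \<in> fraction_grid" using fraction_grid_nonempty by blast
    have "best_value e x \<le> ?R"
      unfolding best_value_def
      by (rule cINF_lower2[OF bdd_below_objective_grid[OF x] u]) (use b[OF u] in simp)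
    ultimately show ?thesis by (simp add: abs_le_iff)
  qed
  then show ?thesis by blast
qed

lemma dr_esm_le_best_value:
  assumes opt: "is_arg_min (dr_esm_objective P \<theta> \<epsilon> e x) (admissible P x) a" and x: "in_range P x"
  shows "dr_esm_objective P \<theta> \<epsilon> e x a \<le> best_value e x"
  unfolding best_value_def
  using opt admissible_fraction_grid[OF x]
  by (intro cINF_greatest[OF fraction_grid_nonempty]) (auto simp: is_arg_min_def not_less)

lemma disutility_rational_below_tendsto:
  assumes s: "s \<in> states P" and u: "u \<in> {0..1}"
  shows "(\<lambda>n. disutility P (rational_below u n * L_max P) s) \<longlonglongrightarrow> disutility P (u * L_max P) s"
proof (cases "u = 0 \<or> u = 1 \<or> L_max P = 0")
  case True
  then have "rational_below u n * L_max P = u * L_max P" for n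
    using rational_below_endpoint[of u n] by auto
  then show ?thesis by (simp only: tendsto_const)
next
  case False
  with u L_max_nonneg have "u * L_max P \<in> {0<..<L_max P}" by auto
  then have "isCont (\<lambda>l. disutility P l s) (u * L_max P)"
    using continuous_on_disutility_interior[OF s] by (simp add: continuous_on_eq_continuous_at)
  then show ?thesis
    by (rule isCont_tendsto_compose) (intro tendsto_mult rational_below_tendsto tendsto_const)
qed

text \<open>Rounding the fractions of \<open>a\<close> down gives actions of the countable family. Their objectives
  converge to that of \<open>a\<close>: a load at an endpoint stays there, and elsewhere the disutility is
  continuous.\<close>

lemma best_value_le_objective:
  assumes x: "in_range P x" and a: "admissible P x a"
  shows "best_value e x \<le> dr_esm_objective P \<theta> \<epsilon> e x a"
proof -
  obtain u0 u1 u2 u3 u4 where u: "{u0, u1, u2, u3, u4} \<subseteq> {0..1}"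
    and au: "a = action_of_fractions x (u0, u1, u2, u3, u4)"
    using admissible_imp_fractions[OF a] .
  define v where "v n = (rational_below u0 n, rational_below u1 n, rational_below u2 n,
    rational_below u3 n, rational_below u4 n)" for n
  have v: "v n \<in> fraction_grid" for n
    using u rational_below_in_grid by (auto simp: v_def fraction_grid_def)
  have s: "state x \<in> states P" using x by (simp add: in_range_def)
  have "(\<lambda>n. dr_esm_objective P \<theta> \<epsilon> e x (action_of_fractions x (v n)))
      \<longlonglongrightarrow> dr_esm_objective P \<theta> \<epsilon> e x a"
    unfolding au v_def dr_esm_objective_def action_of_fractions_def Let_def prod.case action.simps
    using u eps_pos
    by (intro tendsto_intros rational_below_tendsto disutility_rational_below_tendsto[OF s]) auto
  moreover have "best_value e x \<le> dr_esm_objective P \<theta> \<epsilon> e x (action_of_fractions x (v n))" for n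
    unfolding best_value_def by (rule cINF_lower[OF bdd_below_objective_grid[OF x] v])
  ultimately show ?thesis by (intro LIMSEQ_le_const) auto
qed

lemma measurable_exo_components:
  "buy_price \<in> borel_measurable (exo_space P)" "sell_price \<in> borel_measurable (exo_space P)"
  "renewable \<in> borel_measurable (exo_space P)" "state \<in> measurable (exo_space P) (count_space (states P))"
  unfolding exo_space_def by measurable

lemma borel_measurable_best_value:
  "(\<lambda>(e, x). best_value e x) \<in> borel_measurable (borel \<Otimes>\<^sub>M exo_space P)"
proof -
  note [measurable] = measurable_exo_components
  have "countable fraction_grid"
    unfolding fraction_grid_def by (intro countable_SIGMA countable_Int1 countable_rat)
  moreover have "(\<lambda>(e, x). dr_esm_objective P \<theta> \<epsilon> e x (action_of_fractions x u))
      \<in> borel_measurable (borel \<Otimes>\<^sub>M exo_space P)" for u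
  proof (cases u)
    case (fields u0 u1 u2 u3 u4)
    have [measurable]: "(\<lambda>s. disutility P (u0 * L_max P) s) \<in> borel_measurable (count_space (states P))"
      by simp
    show ?thesis
      unfolding fields dr_esm_objective_def action_of_fractions_def Let_def prod.case action.simps
      by measurable
  qed
  ultimately show ?thesis
    unfolding best_value_def case_prod_beta by (intro borel_measurable_cINF_real) auto
qed

end

section \<open>Policies and their expected slot costs\<close>

lemma measurable_finer_source:
  assumes "f \<in> measurable N K" "space N = space N'" "sets N \<subseteq> sets N'"
  shows "f \<in> measurable N' K"
  using assms by (auto simp: measurable_def)

locale controlled_storage = demand_response P M F X + storage_model P \<theta> \<epsilon>
  for P :: "'s dr_params" and M :: "'w measure" and F X \<theta> \<epsilon> +
  fixes E0 :: real
begin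

definition admissible_policy :: "(nat \<Rightarrow> 'w \<Rightarrow> action) \<Rightarrow> bool" where
  "admissible_policy A \<longleftrightarrow> adapted_policy F A \<and>
     (\<forall>t. \<forall>\<omega>\<in>space M. admissible P (X t \<omega>) (A t \<omega>))"

lemma admissible_policyD:
  "admissible_policy A \<Longrightarrow> \<omega> \<in> space M \<Longrightarrow> admissible P (X t \<omega>) (A t \<omega>)"
  by (simp add: admissible_policy_def)

lemma in_range_exo:
  assumes "\<omega> \<in> space M"
  shows "in_range P (X t \<omega>)"
proof -
  have "X t \<omega> \<in> space (exo_space P)"
    using measurable_space[OF exo_adapted] assms by (simp add: space_F)
  then have "state (X t \<omega>) \<in> states P"
    by (auto simp: exo_space_def space_pair_measure)
  with exo_range[OF assms, of t] show ?thesis by (simp add: in_range_def)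
qed

lemma measurable_F_imp_M: "f \<in> measurable (F t) N \<Longrightarrow> f \<in> measurable M N"
  by (rule measurable_finer_source[of f "F t"]) (auto simp: space_F sets_F_subset[THEN subsetD])

lemma measurable_F_mono: "f \<in> measurable (F s) N \<Longrightarrow> s \<le> t \<Longrightarrow> f \<in> measurable (F t) N"
  by (rule measurable_finer_source[of f "F s"]) (simp_all add: space_F sets_F_mono)

lemma measurable_exo: "X t \<in> measurable M (exo_space P)"
  by (rule measurable_F_imp_M[OF exo_adapted])

lemma action_measurable:
  assumes "admissible_policy A"
  shows "(\<lambda>\<omega>. load (A t \<omega>)) \<in> borel_measurable (F t)" "(\<lambda>\<omega>. d_l (A t \<omega>)) \<in> borel_measurable (F t)"
    "(\<lambda>\<omega>. d_c (A t \<omega>)) \<in> borel_measurable (F t)" "(\<lambda>\<omega>. d_s (A t \<omega>)) \<in> borel_measurable (F t)"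
    "(\<lambda>\<omega>. h_s (A t \<omega>)) \<in> borel_measurable (F t)" "(\<lambda>\<omega>. r_c (A t \<omega>)) \<in> borel_measurable (F t)"
  using assms by (auto simp: admissible_policy_def adapted_policy_def)

lemma net_charge_measurable:
  assumes "admissible_policy A"
  shows "(\<lambda>\<omega>. net_charge P (A t \<omega>)) \<in> borel_measurable (F t)"
proof -
  note [measurable] = action_measurable[OF assms, of t]
  show ?thesis unfolding net_charge_def by measurable
qed

lemma energy_Suc_measurable:
  assumes "admissible_policy A"
  shows "energy P E0 A (Suc t) \<in> borel_measurable (F t)"
proof -
  have "(\<lambda>\<omega>. E0 + (\<Sum>\<tau><Suc t. net_charge P (A \<tau> \<omega>))) \<in> borel_measurable (F t)"
    by (intro borel_measurable_add borel_measurable_const borel_measurable_sum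
        measurable_F_mono[OF net_charge_measurable[OF assms]]) auto
  then show ?thesis by (simp add: energy_eq_sum_net_charge[abs_def])
qed

lemma energy_measurable:
  assumes "admissible_policy A"
  shows "energy P E0 A t \<in> borel_measurable M"
proof (cases t)
  case 0
  then show ?thesis by (simp add: energy_eq_sum_net_charge[abs_def])
next
  case (Suc k)
  then show ?thesis using measurable_F_imp_M[OF energy_Suc_measurable[OF assms]] by simp
qed

lemma abs_energy_le:
  assumes "admissible_policy A" "\<omega> \<in> space M"
  shows "\<bar>energy P E0 A t \<omega>\<bar> \<le> \<bar>E0\<bar> + real t * (eta_i P * c_char P + eta_e P * c_dis P)"
proof -
  have "\<bar>\<Sum>\<tau><t. net_charge P (A \<tau> \<omega>)\<bar> \<le> (\<Sum>\<tau><t. \<bar>net_charge P (A \<tau> \<omega>)\<bar>)" by (rule sum_abs)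
  also have "\<dots> \<le> (\<Sum>\<tau><t. eta_i P * c_char P + eta_e P * c_dis P)"
    by (intro sum_mono abs_net_charge_le[OF admissible_policyD[OF assms]])
  finally show ?thesis
    unfolding energy_eq_sum_net_charge by simp
qed

lemma integrable_bounded:
  fixes f :: "'w \<Rightarrow> real"
  assumes "f \<in> borel_measurable M" "\<And>\<omega>. \<omega> \<in> space M \<Longrightarrow> \<bar>f \<omega>\<bar> \<le> K"
  shows "integrable M f"
  using assms by (intro integrable_const_bound[of _ K] AE_I2) auto

lemma integrable_net_charge:
  assumes "admissible_policy A"
  shows "integrable M (\<lambda>\<omega>. net_charge P (A t \<omega>))"
  by (rule integrable_bounded[OF measurable_F_imp_M[OF net_charge_measurable[OF assms]]])
    (rule abs_net_charge_le[OF admissible_policyD[OF assms]])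

lemma integrable_energy:
  assumes "admissible_policy A"
  shows "integrable M (energy P E0 A t)"
  by (rule integrable_bounded[OF energy_measurable[OF assms] abs_energy_le[OF assms]])

lemma integrable_energy_square:
  assumes "admissible_policy A"
  shows "integrable M (\<lambda>\<omega>. (energy P E0 A t \<omega> - \<theta>)\<^sup>2)"
proof (rule integrable_bounded)
  show "(\<lambda>\<omega>. (energy P E0 A t \<omega> - \<theta>)\<^sup>2) \<in> borel_measurable M"
    using energy_measurable[OF assms, of t] by simp
  fix \<omega> assume "\<omega> \<in> space M"
  from abs_energy_le[OF assms this, of t]
  have "\<bar>energy P E0 A t \<omega> - \<theta>\<bar> \<le> \<bar>E0\<bar> + real t * (eta_i P * c_char P + eta_e P * c_dis P) + \<bar>\<theta>\<bar>"
    by linarith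
  then have "\<bar>energy P E0 A t \<omega> - \<theta>\<bar>\<^sup>2
      \<le> (\<bar>E0\<bar> + real t * (eta_i P * c_char P + eta_e P * c_dis P) + \<bar>\<theta>\<bar>)\<^sup>2"
    by (intro power_mono) auto
  then show "\<bar>(energy P E0 A t \<omega> - \<theta>)\<^sup>2\<bar>
      \<le> (\<bar>E0\<bar> + real t * (eta_i P * c_char P + eta_e P * c_dis P) + \<bar>\<theta>\<bar>)\<^sup>2"
    by simp
qed

lemma integrable_slot_cost:
  assumes "admissible_policy A"
  shows "integrable M (\<lambda>\<omega>. slot_cost P (X t \<omega>) (A t \<omega>))"
proof -
  note [measurable] = measurable_exo[of t] measurable_exo_components
    action_measurable[OF assms, of t, THEN measurable_F_imp_M]
  have "(\<lambda>\<omega>. disutility P (load (A t \<omega>)) (state (X t \<omega>))) \<in> borel_measurable M"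
  proof (rule measurable_compose_countable'[where I = "states P"])
    show "(\<lambda>\<omega>. disutility P (load (A t \<omega>)) s) \<in> borel_measurable M" if "s \<in> states P" for s
      using admissible_policyD[OF assms, of _ t]
      by (intro borel_measurable_disutility[OF that]) (auto simp: admissible_def)
    show "(\<lambda>\<omega>. state (X t \<omega>)) \<in> measurable M (count_space (states P))" by measurable
  qed (use states_finite in \<open>simp add: countable_finite\<close>)
  note [measurable] = this
  obtain K where K: "\<And>x a. in_range P x \<Longrightarrow> admissible P x a \<Longrightarrow> \<bar>slot_cost P x a\<bar> \<le> K"
    using slot_cost_bounded by blast
  show ?thesis
  proof (rule integrable_bounded)
    show "(\<lambda>\<omega>. slot_cost P (X t \<omega>) (A t \<omega>)) \<in> borel_measurable M"
      unfolding slot_cost_def by measurable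
  qed (rule K[OF in_range_exo admissible_policyD[OF assms]])
qed

lemma integrable_best_value:
  assumes Y: "Y \<in> borel_measurable M" and b: "\<And>\<omega>. \<omega> \<in> space M \<Longrightarrow> \<bar>Y \<omega>\<bar> \<le> R"
  shows "integrable M (\<lambda>\<omega>. best_value (Y \<omega>) (X t \<omega>))"
proof -
  obtain K where K: "\<And>e x. in_range P x \<Longrightarrow>
     \<bar>best_value e x\<bar> \<le> K + \<bar>e - \<theta>\<bar> * (eta_i P * c_char P + eta_e P * c_dis P)"
    using best_value_bounded by blast
  show ?thesis
  proof (rule integrable_bounded)
    show "(\<lambda>\<omega>. best_value (Y \<omega>) (X t \<omega>)) \<in> borel_measurable M"
      using measurable_compose[OF measurable_Pair[OF Y measurable_exo] borel_measurable_best_value]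
      by simp
    fix \<omega> assume \<omega>: "\<omega> \<in> space M"
    have "\<bar>Y \<omega> - \<theta>\<bar> * (eta_i P * c_char P + eta_e P * c_dis P)
        \<le> (R + \<bar>\<theta>\<bar>) * (eta_i P * c_char P + eta_e P * c_dis P)"
      using b[OF \<omega>] i_pos e_ge_1 c_char_nonneg c_dis_nonneg by (intro mult_right_mono) auto
    with K[OF in_range_exo[OF \<omega>], of "Y \<omega>" t]
    show "\<bar>best_value (Y \<omega>) (X t \<omega>)\<bar>
        \<le> K + (R + \<bar>\<theta>\<bar>) * (eta_i P * c_char P + eta_e P * c_dis P)" by linarith
  qed
qed

section \<open>Comparison with an arbitrary policy\<close>

definition expected_value :: "real \<Rightarrow> real" where
  "expected_value e = (\<integral>\<omega>. best_value e (X 0 \<omega>) \<partial>M)"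

lemma borel_measurable_best_value_level: "best_value e \<in> borel_measurable (exo_space P)"
proof -
  have "(\<lambda>x. (e, x)) \<in> measurable (exo_space P) (borel \<Otimes>\<^sub>M exo_space P)" by measurable
  from measurable_compose[OF this borel_measurable_best_value] show ?thesis by simp
qed

lemma expected_value_distr: "(\<integral>x. best_value e x \<partial>distr M (exo_space P) (X t)) = expected_value e"
proof -
  have "(\<integral>x. best_value e x \<partial>distr M (exo_space P) (X 0)) = expected_value e"
    unfolding expected_value_def
    by (rule integral_distr[OF measurable_exo borel_measurable_best_value_level])
  then show ?thesis using exo_ident[of t] by simp
qed

lemma expected_value_slot: "(\<integral>\<omega>. best_value e (X t \<omega>) \<partial>M) = expected_value e"
  unfolding expected_value_distr[of t e, symmetric]
  by (rule integral_distr[OF measurable_exo borel_measurable_best_value_level, symmetric])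

text \<open>For a fixed level \<open>e\<close>, every slot of every policy pays at least \<open>expected_value e\<close> in cost plus
  weighted drift, because each slot sees an observation with the same law. Over many slots the
  drift terms telescope to a bounded amount when the storage is finite, so only the cost is left.
  This replaces the usual reduction to a stationary randomized policy.\<close>

lemma expected_value_le_avg_cost:
  assumes A: "admissible_policy A"
    and lo: "\<And>t \<omega>. \<omega> \<in> space M \<Longrightarrow> C \<le> energy P E0 A t \<omega>"
    and up: "\<And>t \<omega>. \<omega> \<in> space M \<Longrightarrow> energy P E0 A t \<omega> \<le> C'"
  shows "ereal (\<epsilon> * expected_value e) \<le> avg_cost P M X A"
proof -
  define f where "f t = (\<integral>\<omega>. slot_cost P (X t \<omega>) (A t \<omega>) \<partial>M)" for t
  define n where "n t = (\<integral>\<omega>. net_charge P (A t \<omega>) \<partial>M)" for t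
  note int = integrable_slot_cost[OF A] integrable_net_charge[OF A]
  have slot: "expected_value e \<le> f t / \<epsilon> + (e - \<theta>) * n t" for t
  proof -
    have "expected_value e = (\<integral>\<omega>. best_value e (X t \<omega>) \<partial>M)" by (rule expected_value_slot[symmetric])
    also have "\<dots> \<le> (\<integral>\<omega>. slot_cost P (X t \<omega>) (A t \<omega>) / \<epsilon> + (e - \<theta>) * net_charge P (A t \<omega>) \<partial>M)"
    proof (rule integral_mono)
      show "integrable M (\<lambda>\<omega>. best_value e (X t \<omega>))"
        by (rule integrable_best_value[of "\<lambda>_. e" "\<bar>e\<bar>"]) auto
      show "integrable M (\<lambda>\<omega>. slot_cost P (X t \<omega>) (A t \<omega>) / \<epsilon> + (e - \<theta>) * net_charge P (A t \<omega>))"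
        using int by (intro Bochner_Integration.integrable_add integrable_mult_right) auto
      fix \<omega> assume \<omega>: "\<omega> \<in> space M"
      show "best_value e (X t \<omega>) \<le> slot_cost P (X t \<omega>) (A t \<omega>) / \<epsilon> + (e - \<theta>) * net_charge P (A t \<omega>)"
        using best_value_le_objective[OF in_range_exo[OF \<omega>] admissible_policyD[OF A \<omega>], of e]
          objective_eq_drift_plus_penalty[OF admissible_policyD[OF A \<omega>]] by simp
    qed
    also have "\<dots> = f t / \<epsilon> + (e - \<theta>) * n t"
      unfolding f_def n_def using int by (subst Bochner_Integration.integral_add) auto
    finally show ?thesis .
  qed
  have tele: "\<bar>\<Sum>t<T. n t\<bar> \<le> \<bar>C\<bar> + \<bar>C'\<bar> + \<bar>E0\<bar>" for T
  proof -
    have eq: "(\<Sum>t<T. n t) = (\<integral>\<omega>. energy P E0 A T \<omega> - E0 \<partial>M)"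
      unfolding n_def energy_eq_sum_net_charge using int by (simp add: Bochner_Integration.integral_sum)
    have "\<bar>\<integral>\<omega>. energy P E0 A T \<omega> - E0 \<partial>M\<bar> \<le> (\<integral>\<omega>. \<bar>energy P E0 A T \<omega> - E0\<bar> \<partial>M)"
      by (rule integral_abs_bound)
    also have "\<dots> \<le> (\<integral>\<omega>. \<bar>C\<bar> + \<bar>C'\<bar> + \<bar>E0\<bar> \<partial>M)"
    proof (rule integral_mono)
      fix \<omega> assume "\<omega> \<in> space M"
      from lo[OF this, of T] up[OF this, of T]
      show "\<bar>energy P E0 A T \<omega> - E0\<bar> \<le> \<bar>C\<bar> + \<bar>C'\<bar> + \<bar>E0\<bar>" by linarith
    qed (use integrable_energy[OF A] in auto)
    finally show ?thesis unfolding eq by (simp add: prob_space)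
  qed
  define R where "R = \<epsilon> * \<bar>e - \<theta>\<bar> * (\<bar>C\<bar> + \<bar>C'\<bar> + \<bar>E0\<bar>)"
  have avg: "\<epsilon> * expected_value e - R / real T \<le> 1 / real T * (\<Sum>t<T. f t)" if "0 < T" for T
  proof -
    have "real T * expected_value e \<le> (\<Sum>t<T. f t / \<epsilon> + (e - \<theta>) * n t)"
      using sum_mono[of "{..<T}" "\<lambda>_. expected_value e"] slot by simp
    also have "\<dots> = (\<Sum>t<T. f t) / \<epsilon> + (e - \<theta>) * (\<Sum>t<T. n t)"
      by (simp add: sum.distrib sum_divide_distrib sum_distrib_left)
    also have "(e - \<theta>) * (\<Sum>t<T. n t) \<le> \<bar>e - \<theta>\<bar> * (\<bar>C\<bar> + \<bar>C'\<bar> + \<bar>E0\<bar>)"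
    proof -
      have "(e - \<theta>) * (\<Sum>t<T. n t) \<le> \<bar>e - \<theta>\<bar> * \<bar>\<Sum>t<T. n t\<bar>"
        unfolding abs_mult[symmetric] by (rule abs_ge_self)
      also have "\<dots> \<le> \<bar>e - \<theta>\<bar> * (\<bar>C\<bar> + \<bar>C'\<bar> + \<bar>E0\<bar>)"
        by (intro mult_left_mono tele) simp
      finally show ?thesis .
    qed
    finally have "\<epsilon> * (real T * expected_value e)
        \<le> \<epsilon> * ((\<Sum>t<T. f t) / \<epsilon> + \<bar>e - \<theta>\<bar> * (\<bar>C\<bar> + \<bar>C'\<bar> + \<bar>E0\<bar>))"
      using eps_pos by simp
    also have "\<dots> = (\<Sum>t<T. f t) + R" using eps_pos by (simp add: R_def distrib_left)
    finally have "\<epsilon> * expected_value e \<le> ((\<Sum>t<T. f t) + R) / real T"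
      using that by (simp add: pos_le_divide_eq mult.assoc mult.commute mult.left_commute)
    then show ?thesis by (simp add: add_divide_distrib)
  qed
  have "(\<lambda>T. \<epsilon> * expected_value e - R / real T) \<longlonglongrightarrow> \<epsilon> * expected_value e - 0"
    by (intro tendsto_diff tendsto_const lim_const_over_n)
  then have "(\<lambda>T. ereal (\<epsilon> * expected_value e - R / real T)) \<longlonglongrightarrow> ereal (\<epsilon> * expected_value e)"
    by (simp add: tendsto_ereal)
  then have "ereal (\<epsilon> * expected_value e) = limsup (\<lambda>T. ereal (\<epsilon> * expected_value e - R / real T))"
    using lim_imp_Limsup[OF trivial_limit_sequentially] by metis
  also have "\<dots> \<le> limsup (\<lambda>T. ereal (1 / real T * (\<Sum>t<T. f t)))"
  proof (rule Limsup_mono)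
    show "\<forall>\<^sub>F T in sequentially. ereal (\<epsilon> * expected_value e - R / real T)
        \<le> ereal (1 / real T * (\<Sum>t<T. f t))"
      using eventually_gt_at_top[of 0] by eventually_elim (use avg in simp)
  qed
  finally show ?thesis unfolding avg_cost_def f_def .
qed

section \<open>The Lyapunov drift bound for DR-ESM\<close>

text \<open>The level after slot \<open>t\<close> is a function of the past up to \<open>t\<close>, from which the next observation is
  independent. The joint law is a product because it factorizes on measurable rectangles.\<close>

lemma joint_law_energy_exo:
  assumes "admissible_policy A"
  shows "distr M borel (energy P E0 A (Suc t)) \<Otimes>\<^sub>M distr M (exo_space P) (X (Suc t))
    = distr M (borel \<Otimes>\<^sub>M exo_space P) (\<lambda>\<omega>. (energy P E0 A (Suc t) \<omega>, X (Suc t) \<omega>))"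
    (is "?DE \<Otimes>\<^sub>M ?DX = ?J")
proof (rule pair_measure_eqI)
  let ?Y = "energy P E0 A (Suc t)"
  note rv = energy_measurable[OF assms, of "Suc t"] measurable_exo[of "Suc t"]
  interpret E: prob_space ?DE by (rule prob_space_distr[OF rv(1)])
  interpret O: prob_space ?DX by (rule prob_space_distr[OF rv(2)])
  show "sigma_finite_measure ?DE" "sigma_finite_measure ?DX" by unfold_locales
  show "sets (?DE \<Otimes>\<^sub>M ?DX) = sets ?J" by simp
  fix C D assume "C \<in> sets ?DE" "D \<in> sets ?DX"
  then have C: "C \<in> sets borel" and D: "D \<in> sets (exo_space P)" by simp_all
  let ?c = "?Y -` C \<inter> space M" and ?d = "X (Suc t) -` D \<inter> space M"
  have "?c \<in> sets (F t)"
    using measurable_sets[OF energy_Suc_measurable[OF assms] C] by (simp only: space_F)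
  then have "prob (?c \<inter> ?d) = prob ?c * prob ?d"
    using D by (intro indep_setD[OF exo_indep_past[of t]]) auto
  moreover have "(\<lambda>\<omega>. (?Y \<omega>, X (Suc t) \<omega>)) -` (C \<times> D) \<inter> space M = ?c \<inter> ?d" by auto
  ultimately show "emeasure ?DE C * emeasure ?DX D = emeasure ?J (C \<times> D)"
    using C D rv
    by (simp add: emeasure_distr measurable_Pair emeasure_eq_measure ennreal_mult' del: energy.simps)
qed

text \<open>The observation of a slot is independent of the energy level at its start, so the
  expectation may be taken over the observation first, with the level held fixed.\<close>

lemma expectation_best_value_le:
  assumes A: "admissible_policy A" and g: "\<And>e. expected_value e \<le> g"
  shows "(\<integral>\<omega>. best_value (energy P E0 A t \<omega>) (X t \<omega>) \<partial>M) \<le> g"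
proof (cases t)
  case 0
  with g[of E0] show ?thesis by (simp add: expected_value_def)
next
  case (Suc k)
  let ?Y = "energy P E0 A (Suc k)"
  let ?DE = "distr M borel ?Y" and ?DX = "distr M (exo_space P) (X (Suc k))"
  note rv = energy_measurable[OF A, of "Suc k"] measurable_exo[of "Suc k"]
  interpret E: prob_space ?DE by (rule prob_space_distr[OF rv(1)])
  interpret Xd: prob_space ?DX by (rule prob_space_distr[OF rv(2)])
  interpret EX: pair_prob_space ?DE ?DX ..
  have joint: "?DE \<Otimes>\<^sub>M ?DX = distr M (borel \<Otimes>\<^sub>M exo_space P) (\<lambda>\<omega>. (?Y \<omega>, X (Suc k) \<omega>))"
    by (rule joint_law_energy_exo[OF A])
  have int: "integrable (?DE \<Otimes>\<^sub>M ?DX) (\<lambda>(e, x). best_value e x)"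
    unfolding joint
    using integrable_best_value[OF rv(1) abs_energy_le[OF A]]
    by (subst integrable_distr_eq[OF measurable_Pair[OF rv] borel_measurable_best_value]) simp
  have "(\<integral>\<omega>. best_value (?Y \<omega>) (X (Suc k) \<omega>) \<partial>M) = (\<integral>z. (case z of (e, x) \<Rightarrow> best_value e x) \<partial>(?DE \<Otimes>\<^sub>M ?DX))"
    unfolding joint
    by (subst integral_distr[OF measurable_Pair[OF rv] borel_measurable_best_value]) simp
  also have "\<dots> = (\<integral>e. (\<integral>x. best_value e x \<partial>?DX) \<partial>?DE)"
    using EX.integral_fst'[OF int] by simp
  also have "\<dots> = (\<integral>e. expected_value e \<partial>?DE)" by (simp only: expected_value_distr)
  also have "\<dots> \<le> (\<integral>e. g \<partial>?DE)"
  proof (rule integral_mono)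
    show "integrable ?DE expected_value"
      using EX.integrable_fst'[OF int] by (simp add: expected_value_distr)
  qed (use g in auto)
  also have "\<dots> = g" using E.prob_space by simp
  finally show ?thesis unfolding Suc .
qed

text \<open>In each slot DR-ESM attains cost plus first-order drift at most \<open>g\<close> in expectation, and the
  second-order term of the drift of \<open>(E - \<theta>)\<^sup>2 / 2\<close> is at most \<open>B\<close>. Summing over \<open>T\<close> slots
  telescopes the Lyapunov function, which is nonnegative at the end. Division by \<open>T\<close> removes its
  initial value.\<close>

lemma dr_esm_avg_cost_le:
  assumes A: "admissible_policy A"
    and opt: "\<And>t \<omega>. \<omega> \<in> space M \<Longrightarrow>
        is_arg_min (dr_esm_objective P \<theta> \<epsilon> (energy P E0 A t \<omega>) (X t \<omega>)) (admissible P (X t \<omega>)) (A t \<omega>)"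
    and g: "\<And>e. expected_value e \<le> g"
    and B: "B = 1 / 2 * ((eta_e P)\<^sup>2 * (c_dis P)\<^sup>2 + (eta_i P)\<^sup>2 * (c_char P)\<^sup>2)"
  shows "avg_cost P M X A \<le> ereal (\<epsilon> * g + B * \<epsilon>)"
proof -
  define f where "f t = (\<integral>\<omega>. slot_cost P (X t \<omega>) (A t \<omega>) \<partial>M)" for t
  define \<Phi> where "\<Phi> t = (\<integral>\<omega>. (energy P E0 A t \<omega> - \<theta>)\<^sup>2 \<partial>M)" for t
  note int = integrable_slot_cost[OF A] integrable_energy_square[OF A]
  have drift: "f t / \<epsilon> + \<Phi> (Suc t) / 2 - \<Phi> t / 2 \<le> g + B" for t
  proof -
    let ?e = "energy P E0 A t" and ?bv = "\<lambda>\<omega>. best_value (energy P E0 A t \<omega>) (X t \<omega>)"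
    have ibv: "integrable M ?bv" by (rule integrable_best_value[OF energy_measurable[OF A] abs_energy_le[OF A]])
    have "f t / \<epsilon> + \<Phi> (Suc t) / 2 - \<Phi> t / 2
        = (\<integral>\<omega>. slot_cost P (X t \<omega>) (A t \<omega>) / \<epsilon> + (energy P E0 A (Suc t) \<omega> - \<theta>)\<^sup>2 / 2 - (?e \<omega> - \<theta>)\<^sup>2 / 2 \<partial>M)"
      unfolding f_def \<Phi>_def using int[of t] int(2)[of "Suc t"] by (simp del: energy.simps)
    also have "\<dots> \<le> (\<integral>\<omega>. ?bv \<omega> + B \<partial>M)"
    proof (rule integral_mono)
      show "integrable M (\<lambda>\<omega>. slot_cost P (X t \<omega>) (A t \<omega>) / \<epsilon> + (energy P E0 A (Suc t) \<omega> - \<theta>)\<^sup>2 / 2 - (?e \<omega> - \<theta>)\<^sup>2 / 2)"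
        using int[of t] int(2)[of "Suc t"] by (simp del: energy.simps)
      show "integrable M (\<lambda>\<omega>. ?bv \<omega> + B)" using ibv by simp
      fix \<omega> assume \<omega>: "\<omega> \<in> space M"
      let ?n = "net_charge P (A t \<omega>)"
      have adm: "admissible P (X t \<omega>) (A t \<omega>)" by (rule admissible_policyD[OF A \<omega>])
      have "(energy P E0 A (Suc t) \<omega> - \<theta>)\<^sup>2 / 2 - (?e \<omega> - \<theta>)\<^sup>2 / 2 = (?e \<omega> - \<theta>) * ?n + ?n\<^sup>2 / 2"
        unfolding energy_Suc_net_charge by (simp add: power2_eq_square field_simps)
      moreover have "?n\<^sup>2 / 2 \<le> B" using net_charge_square_le[OF adm] by (simp add: B)
      moreover have "slot_cost P (X t \<omega>) (A t \<omega>) / \<epsilon> + (?e \<omega> - \<theta>) * ?n \<le> ?bv \<omega>"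
        using dr_esm_le_best_value[OF opt[OF \<omega>, of t] in_range_exo[OF \<omega>]]
          objective_eq_drift_plus_penalty[OF adm, of \<theta> \<epsilon> "?e \<omega>"] by simp
      ultimately show "slot_cost P (X t \<omega>) (A t \<omega>) / \<epsilon> + (energy P E0 A (Suc t) \<omega> - \<theta>)\<^sup>2 / 2
          - (?e \<omega> - \<theta>)\<^sup>2 / 2 \<le> ?bv \<omega> + B" by linarith
    qed
    also have "\<dots> = (\<integral>\<omega>. ?bv \<omega> \<partial>M) + B" using ibv by (simp add: prob_space)
    also have "\<dots> \<le> g + B" using expectation_best_value_le[OF A g] by simp
    finally show ?thesis .
  qed
  have avg: "1 / real T * (\<Sum>t<T. f t) \<le> \<epsilon> * g + B * \<epsilon> + (\<epsilon> * \<Phi> 0 / 2) / real T" if "0 < T" for T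
  proof -
    have "(\<Sum>t<T. f t) / \<epsilon> + \<Phi> T / 2 - \<Phi> 0 / 2 \<le> real T * (g + B)"
    proof (induction T)
      case (Suc T)
      with drift[of T] show ?case by (simp add: add_divide_distrib algebra_simps)
    qed simp
    moreover have "0 \<le> \<Phi> T" unfolding \<Phi>_def by (rule Bochner_Integration.integral_nonneg) simp
    ultimately have "(\<Sum>t<T. f t) / \<epsilon> \<le> real T * (g + B) + \<Phi> 0 / 2" by linarith
    then have "(\<Sum>t<T. f t) \<le> (real T * (g + B) + \<Phi> 0 / 2) * \<epsilon>"
      using eps_pos by (simp add: pos_divide_le_eq)
    then have "1 / real T * (\<Sum>t<T. f t) \<le> 1 / real T * ((real T * (g + B) + \<Phi> 0 / 2) * \<epsilon>)"
      by (intro mult_left_mono) auto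
    also have "\<dots> = \<epsilon> * g + B * \<epsilon> + (\<epsilon> * \<Phi> 0 / 2) / real T" using that by (simp add: field_simps)
    finally show ?thesis .
  qed
  have "avg_cost P M X A = limsup (\<lambda>T. ereal (1 / real T * (\<Sum>t<T. f t)))"
    unfolding avg_cost_def f_def ..
  also have "\<dots> \<le> limsup (\<lambda>T. ereal (\<epsilon> * g + B * \<epsilon> + (\<epsilon> * \<Phi> 0 / 2) / real T))"
  proof (rule Limsup_mono)
    show "\<forall>\<^sub>F T in sequentially. ereal (1 / real T * (\<Sum>t<T. f t))
        \<le> ereal (\<epsilon> * g + B * \<epsilon> + (\<epsilon> * \<Phi> 0 / 2) / real T)"
      using eventually_gt_at_top[of 0] by eventually_elim (use avg in simp)
  qed
  also have "\<dots> = ereal (\<epsilon> * g + B * \<epsilon>)"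
  proof (rule lim_imp_Limsup)
    have "(\<lambda>T. \<epsilon> * g + B * \<epsilon> + (\<epsilon> * \<Phi> 0 / 2) / real T) \<longlonglongrightarrow> \<epsilon> * g + B * \<epsilon> + 0"
      by (intro tendsto_add tendsto_const lim_const_over_n)
    then show "(\<lambda>T. ereal (\<epsilon> * g + B * \<epsilon> + (\<epsilon> * \<Phi> 0 / 2) / real T)) \<longlonglongrightarrow> ereal (\<epsilon> * g + B * \<epsilon>)"
      by (simp add: tendsto_ereal)
  qed simp
  finally show ?thesis .
qed

lemma dr_esm_avg_cost_le_policy:
  assumes A: "admissible_policy A"
    and opt: "\<And>t \<omega>. \<omega> \<in> space M \<Longrightarrow>
        is_arg_min (dr_esm_objective P \<theta> \<epsilon> (energy P E0 A t \<omega>) (X t \<omega>)) (admissible P (X t \<omega>)) (A t \<omega>)"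
    and B: "B = 1 / 2 * ((eta_e P)\<^sup>2 * (c_dis P)\<^sup>2 + (eta_i P)\<^sup>2 * (c_char P)\<^sup>2)"
    and A': "admissible_policy A'"
    and lo: "\<And>t \<omega>. \<omega> \<in> space M \<Longrightarrow> C \<le> energy P E0 A' t \<omega>"
    and up: "\<And>t \<omega>. \<omega> \<in> space M \<Longrightarrow> energy P E0 A' t \<omega> \<le> C'"
  shows "avg_cost P M X A \<le> avg_cost P M X A' + ereal (B * \<epsilon>)"
proof -
  have le: "ereal (\<epsilon> * expected_value e) \<le> avg_cost P M X A'" for e
    by (rule expected_value_le_avg_cost[OF A' lo up])
  show ?thesis
  proof (cases "avg_cost P M X A'")
    case (real v)
    have "expected_value e \<le> v / \<epsilon>" for e
      using le[of e] eps_pos unfolding real by (simp add: field_simps)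
    from dr_esm_avg_cost_le[OF A opt this B] show ?thesis
      using eps_pos unfolding real by simp
  next
    case PInf
    then show ?thesis by simp
  next
    case MInf
    with le[of 0] show ?thesis by simp
  qed
qed

end

section \<open>Performance of DR-ESM\<close>

theorem theorem2:
  fixes P :: "'s dr_params"
    and M :: "'w measure"
    and F :: "nat \<Rightarrow> 'w measure"
    and X :: "nat \<Rightarrow> 'w \<Rightarrow> 's exo"
    and A :: "nat \<Rightarrow> 'w \<Rightarrow> action"
    and \<epsilon> \<theta> E0 B :: real
  assumes "demand_response P M F X"
    and "eta_i P * c_grid P \<ge> eta_e P * L_max P"
    and "\<epsilon> > 0"
    and "\<theta> = max (p_max P) (q_max P) / (\<epsilon> * eta_i P) + eta_e P * min (L_max P) (c_dis P)"
    and "0 \<le> E0" and "E0 \<le> \<theta> + eta_i P * c_char P"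
    and "dr_esm P M F X \<theta> \<epsilon> E0 A"
    and "B = 1 / 2 * ((eta_e P)\<^sup>2 * (c_dis P)\<^sup>2 + (eta_i P)\<^sup>2 * (c_char P)\<^sup>2)"
  shows "(\<forall>t. \<forall>\<omega>\<in>space M.
            (sales_covered P \<theta> \<epsilon> \<longrightarrow> 0 \<le> energy P E0 A t \<omega>) \<and>
            energy P E0 A t \<omega> \<le> \<theta> + eta_i P * c_char P) \<and>
         avg_cost P M X A \<le> optimal_cost P M F X E0 + ereal (B * \<epsilon>)"
proof -
  interpret DR: demand_response P M F X by fact
  have opt: "is_arg_min (dr_esm_objective P \<theta> \<epsilon> (energy P E0 A t \<omega>) (X t \<omega>)) (admissible P (X t \<omega>)) (A t \<omega>)"
    if "\<omega> \<in> space M" for t \<omega>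
    using assms(7) that by (simp add: dr_esm_def)
  \<comment> \<open>The capacities are nonnegative because some action is admissible.\<close>
  obtain \<omega>0 where \<omega>0: "\<omega>0 \<in> space M" using DR.not_empty by blast
  have adm0: "admissible P (X 0 \<omega>0) (A 0 \<omega>0)" using opt[OF \<omega>0, of 0] by (simp add: is_arg_min_def)
  interpret controlled_storage P M F X \<theta> \<epsilon> E0
    by unfold_locales
      (use adm0 assms DR.eta_e_ge_1 DR.eta_i_pos DR.eta_i_le_1 DR.finite_states DR.convex_disutility
        in \<open>auto simp: admissible_def\<close>)
  have A: "admissible_policy A"
    using assms(7) by (auto simp: admissible_policy_def dr_esm_def is_arg_min_def)
  have up: "energy P E0 A t \<omega> \<le> \<theta> + eta_i P * c_char P" if \<omega>: "\<omega> \<in> space M" for t \<omega>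
  proof (induction t)
    case 0
    then show ?case using assms(6) by simp
  next
    case (Suc t)
    from dr_esm_upper_bound_step[OF opt[OF \<omega>] in_range_exo[OF \<omega>] Suc]
    show ?case unfolding energy_Suc_net_charge .
  qed
  have lo: "0 \<le> energy P E0 A t \<omega>" if cov: "sales_covered P \<theta> \<epsilon>" and \<omega>: "\<omega> \<in> space M" for t \<omega>
  proof (induction t)
    case 0
    then show ?case using assms(5) by simp
  next
    case (Suc t)
    from dr_esm_lower_bound_step[OF opt[OF \<omega>] in_range_exo[OF \<omega>] Suc assms(4) cov]
    show ?case unfolding energy_Suc_net_charge .
  qed
  have cost: "avg_cost P M X A \<le> avg_cost P M X A' + ereal (B * \<epsilon>)"
    if f: "feasible_policy P M F X E0 A'" and c: "finite_capacity P M E0 A'" for A'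
  proof -
    obtain C where C: "\<And>t \<omega>. \<omega> \<in> space M \<Longrightarrow> energy P E0 A' t \<omega> \<le> C"
      using c by (auto simp: finite_capacity_def)
    have A': "admissible_policy A'" using f by (simp add: feasible_policy_def admissible_policy_def)
    \<comment> \<open>The energy-availability condition of the competing policy keeps its level nonnegative.\<close>
    have lo': "0 \<le> energy P E0 A' t \<omega>" if \<omega>: "\<omega> \<in> space M" for t \<omega>
    proof -
      have "0 \<le> d_s (A' t \<omega>) + h_s (A' t \<omega>)"
        using admissible_policyD[OF A' \<omega>, of t] by (simp add: admissible_def)
      then have "0 \<le> eta_e P * (d_s (A' t \<omega>) + h_s (A' t \<omega>))" using e_ge_1 by simp
      also have "\<dots> \<le> energy P E0 A' t \<omega>" using f \<omega> by (simp add: feasible_policy_def)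
      finally show ?thesis .
    qed
    show ?thesis by (rule dr_esm_avg_cost_le_policy[OF A opt assms(8) A' lo' C])
  qed
  have "avg_cost P M X A - ereal (B * \<epsilon>) \<le> optimal_cost P M F X E0"
    unfolding optimal_cost_def
    by (rule INF_greatest) (use cost in \<open>auto simp: ereal_minus_le\<close>)
  then have "avg_cost P M X A \<le> optimal_cost P M F X E0 + ereal (B * \<epsilon>)"
    by (simp add: ereal_minus_le)
  with up lo show ?thesis by blast
qed

end
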